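(* Let $n\ge 3$ and let $a=(a_1,\dots,a_n)$ be an area sequence. Let $\ell$ be an integer with $2\le \ell\le n-1$ and let $i\in[n]$ satisfy $a_{i-1}+\ell-1\le a_i$, where by convention $a_0=1$. For $z=0,1,\dots,\ell$ let $a^{z}$ be the sequence with $a^{z}_j=a_j$ for $j\neq i$ and $a^{z}_i=a_i-z$, and assume these $a^z$ are area sequences; let $G_z$ be the graph with area sequence $a^z$ (so $G_0$ is the graph of $a$). Suppose moreover that $$a_{i+a_i-1}=a_{i+a_i}+1,\quad a_{i+a_i-2}=a_{i+a_i-1}+1,\quad \dots,\quad a_{i+a_i-\ell+1}=a_{i+a_i-\ell+2}+1 .$$ Then for every $1\le k\le \ell-1$: (a) $\mathrm{LLT}_{G_0}(\mathbf{x};q)+q[k]_q\,\mathrm{LLT}_{G_{k+1}}(\mathbf{x};q)=[k+1]_q\,\mathrm{LLT}_{G_k}(\mathbf{x};q)$; (b) $[\ell-k]_q\,\mathrm{LLT}_{G_0}(\mathbf{x};q)+q^{\ell-k}[k]_q\,\mathrm{LLT}_{G_\ell}(\mathbf{x};q)=[\ell]_q\,\mathrm{LLT}_{G_k}(\mathbf{x};q)$; and equivalently the same two identities hold with $\mathrm{LLT}_{G_z}$ replaced by $X_{G_z}$ throughout: (a$'$) $X_{G_0}(\mathbf{x};q)+q[k]_qX_{G_{k+1}}(\mathbf{x};q)=[k+1]_qX_{G_k}(\mathbf{x};q)$; (b$'$) $[\ell-k]_qX_{G_0}(\mathbf{x};q)+q^{\ell-k}[k]_qX_{G_\ell}(\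mathbf{x};q)=[\ell]_qX_{G_k}(\mathbf{x};q)$.
   Context: For a positive integer $n$, $[n]=\{1,\dots,n\}$, $[n]_q=1+q+\dots+q^{n-1}$ ($[0]_q=0$). An area sequence of length $n$ is a sequence $(a_1,\dots,a_n)$ of nonnegative integers with $a_n=0$, $a_j\le n-j$ and $a_{j+1}\ge a_j-1$ for all $j$; it determines the graph on vertex set $[n]$ with edge set $\{\{j,k\}: j<k\le j+a_j\}$ (these are exactly the incomparability graphs of natural unit interval orders on $[n]$, and $a_j$ is the number of neighbours $k>j$ of $j$). For a graph $G$ on $[n]$ and a map $\kappa:[n]\to\mathbb{Z}_{>0}$, let $\mathrm{asc}(\kappa)$ be the number of edges $\{j,k\}$ with $j<k$ and $\kappa(j)<\kappa(k)$, and $x^\kappa=\prod_{v}x_{\kappa(v)}$. The chromatic quasisymmetric function is $X_G(\mathbf{x};q)=\sum_{\kappa}q^{\mathrm{asc}(\kappa)}x^\kappa$ over proper colorings $\kappa$ (adjacent vertices get distinct colors), and the unicellular LLT polynomial is $\mathrm{LLT}_G(\mathbf{x};q)=\sum_{\kappa}q^{\mathrm{asc}(\kappa)}x^\kappa$ over all maps $\kappa:[n]\to\mathbb{Z}_{>0}$. *)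

theory Defs
  imports
    "HOL-Computational_Algebra.Polynomial"
    "HOL-Library.FuncSet"
    "HOL-Library.Function_Algebras"
    "HOL-Library.Poly_Mapping"
begin

text \<open>
  Formal power series in \<open>x\<^sub>1, x\<^sub>2, \<dots>\<close> over \<open>\<int>[q]\<close> are represented by their coefficient
  functions: the exponent vector \<open>m\<close> is sent to the coefficient of \<open>x\<^sup>m\<close>. Addition is the
  pointwise one of \<^theory>\<open>HOL-Library.Function_Algebras\<close>; the pointwise product given by
  that theory is not the product of power series and is not used.
\<close>

type_synonym series = "(nat \<Rightarrow>\<^sub>0 nat) \<Rightarrow> int poly"

definition scale :: "int poly \<Rightarrow> series \<Rightarrow> series" (infixr \<open>\<cdot>\<close> 75) where
  "c \<cdot> F = (\<lambda>m. c * F m)"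

definition q :: "int poly" where
  "q = monom 1 1"

definition q_int :: "nat \<Rightarrow> int poly" where
  "q_int n = (\<Sum>i<n. q ^ i)"

text \<open>
  Sequences are functions of which only the values at \<open>1, \<dots>, n\<close> matter. The values are
  integers, so that the subtraction in \<open>lower\<close> is not truncated.
\<close>

definition area_sequence :: "nat \<Rightarrow> (nat \<Rightarrow> int) \<Rightarrow> bool" where
  "area_sequence n a \<longleftrightarrow>
     (\<forall>j\<in>{1..n}. 0 \<le> a j \<and> a j \<le> int n - int j) \<and>
     a n = 0 \<and>
     (\<forall>j. 1 \<le> j \<and> j < n \<longrightarrow> a (j + 1) \<ge> a j - 1)"

definition lower :: "(nat \<Rightarrow> int) \<Rightarrow> nat \<Rightarrow> nat \<Rightarrow> nat \<Rightarrow> int" where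
  "lower a i z = a(i := a i - int z)"

definition area_graph :: "nat \<Rightarrow> (nat \<Rightarrow> int) \<Rightarrow> nat set set" where
  "area_graph n a =
     {{j, k} | j k. j \<in> {1..n} \<and> k \<in> {1..n} \<and> j < k \<and> int k \<le> int j + a j}"

definition colorings :: "nat \<Rightarrow> (nat \<Rightarrow> nat) set" where
  "colorings n = {1..n} \<rightarrow>\<^sub>E {1..}"

definition proper :: "nat set set \<Rightarrow> (nat \<Rightarrow> nat) \<Rightarrow> bool" where
  "proper E \<kappa> \<longleftrightarrow> (\<forall>j k. {j, k} \<in> E \<longrightarrow> \<kappa> j \<noteq> \<kappa> k)"

definition asc :: "nat set set \<Rightarrow> (nat \<Rightarrow> nat) \<Rightarrow> nat" where
  "asc E \<kappa> = card {e \<in> E. \<exists>j k. e = {j, k} \<and> j < k \<and> \<kappa> j < \<kappa> k}"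

definition exponent :: "nat \<Rightarrow> (nat \<Rightarrow> nat) \<Rightarrow> (nat \<Rightarrow>\<^sub>0 nat)" where
  "exponent n \<kappa> = (\<Sum>v\<in>{1..n}. Poly_Mapping.single (\<kappa> v) 1)"

definition chromatic :: "nat \<Rightarrow> nat set set \<Rightarrow> series" where
  "chromatic n E =
     (\<lambda>m. \<Sum>\<kappa> | \<kappa> \<in> colorings n \<and> proper E \<kappa> \<and> exponent n \<kappa> = m. q ^ asc E \<kappa>)"

definition LLT :: "nat \<Rightarrow> nat set set \<Rightarrow> series" where
  "LLT n E = (\<lambda>m. \<Sum>\<kappa> | \<kappa> \<in> colorings n \<and> exponent n \<kappa> = m. q ^ asc E \<kappa>)"

text \<open>The sums above are genuinely finite, so no coefficient is zero by default.\<close>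

lemma finite_colorings_exponent: "finite {\<kappa> \<in> colorings n. exponent n \<kappa> = m}"
proof (rule finite_subset)
  show "{\<kappa> \<in> colorings n. exponent n \<kappa> = m} \<subseteq> {1..n} \<rightarrow>\<^sub>E Poly_Mapping.keys m"
  proof
    fix \<kappa> assume "\<kappa> \<in> {\<kappa> \<in> colorings n. exponent n \<kappa> = m}"
    then have \<kappa>: "\<kappa> \<in> {1..n} \<rightarrow>\<^sub>E {1..}" and m: "m = exponent n \<kappa>"
      by (auto simp: colorings_def)
    have "\<kappa> v \<in> Poly_Mapping.keys m" if v: "v \<in> {1..n}" for v
    proof -
      have "Poly_Mapping.lookup m (\<kappa> v) = (\<Sum>u\<in>{1..n}. Poly_Mapping.lookup (Poly_Mapping.single (\<kappa> u) (1::nat)) (\<kappa> v))"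
        by (simp add: m exponent_def Poly_Mapping.lookup_sum)
      also have "\<dots> \<ge> Poly_Mapping.lookup (Poly_Mapping.single (\<kappa> v) (1::nat)) (\<kappa> v)"
        using v by (intro member_le_sum) auto
      finally show ?thesis by (simp add: in_keys_iff)
    qed
    with \<kappa> show "\<kappa> \<in> {1..n} \<rightarrow>\<^sub>E Poly_Mapping.keys m" by (auto simp: PiE_iff)
  qed
qed (simp add: finite_PiE)

end

theory Submission
  imports Defs "HOL-Combinatorics.Transposition"
begin

text \<open>
  All four identities are consequences of the recurrence
  \<open>F\<^sub>j + q F\<^bsub>j+2\<^esub> = (1 + q) F\<^bsub>j+1\<^esub>\<close>, where \<open>F\<^sub>z\<close> is the LLT polynomial or the chromatic
  quasisymmetric function of \<open>G\<^sub>z\<close>. With \<open>s = i + a\<^sub>i - j - 1\<close>, the vertex \<open>i\<close> is joined to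
  both of \<open>s\<close>, \<open>s + 1\<close> in \<open>G\<^sub>j\<close>, only to \<open>s\<close> in \<open>G\<^bsub>j+1\<^esub>\<close>, and to neither in \<open>G\<^bsub>j+2\<^esub>\<close>; apart
  from that, the adjacent vertices \<open>s\<close> and \<open>s + 1\<close> have the same neighbours, on the same side.
  Hence the recurrence already holds for the sum of the contributions of a coloring and of the
  coloring obtained from it by exchanging the colors of \<open>s\<close> and \<open>s + 1\<close>.
\<close>

subsection \<open>Generating functions of edge weights\<close>

text \<open>Both kinds of series have this form, with \<open>asc_weight\<close> and
  \<open>proper_asc_weight\<close>, so one argument serves for both.\<close>

definition weight_series :: "(nat \<Rightarrow> nat \<Rightarrow> int poly) \<Rightarrow> nat \<Rightarrow> (nat \<times> nat) set \<Rightarrow> series" where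
  "weight_series g n R =
     (\<lambda>m. \<Sum>\<kappa> | \<kappa> \<in> colorings n \<and> exponent n \<kappa> = m. \<Prod>(j, k)\<in>R. g (\<kappa> j) (\<kappa> k))"

definition asc_weight :: "nat \<Rightarrow> nat \<Rightarrow> int poly" where
  "asc_weight x y = (if x < y then q else 1)"

text \<open>The value 0 on equal colors removes improper colorings, so that the sum may run over all
  colorings.\<close>

definition proper_asc_weight :: "nat \<Rightarrow> nat \<Rightarrow> int poly" where
  "proper_asc_weight x y = (if x < y then q else if x = y then 0 else 1)"

text \<open>Listing the smaller end first lets an asymmetric weight be evaluated on an edge.\<close>

definition area_edges :: "nat \<Rightarrow> (nat \<Rightarrow> int) \<Rightarrow> (nat \<times> nat) set" where
  "area_edges n a = {(j, k). j \<in> {1..n} \<and> k \<in> {1..n} \<and> j < k \<and> int k \<le> int j + a j}"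

lemma finite_area_edges [simp]: "finite (area_edges n a)"
  by (rule finite_subset[of _ "{1..n} \<times> {1..n}"]) (auto simp: area_edges_def)

lemma area_graph_eq_image: "area_graph n a = (\<lambda>(j, k). {j, k}) ` area_edges n a"
  unfolding area_graph_def area_edges_def by auto

lemma proper_area_graph_iff:
  "proper (area_graph n a) \<kappa> \<longleftrightarrow> (\<forall>(j, k)\<in>area_edges n a. \<kappa> j \<noteq> \<kappa> k)"
  unfolding proper_def area_graph_eq_image
  by (force simp: doubleton_eq_iff)

lemma asc_area_graph:
  "asc (area_graph n a) \<kappa> = card {(j, k) \<in> area_edges n a. \<kappa> j < \<kappa> k}"
proof -
  have less: "j < k" if "(j, k) \<in> area_edges n a" for j k
    using that by (auto simp: area_edges_def)
  have inj: "inj_on (\<lambda>(j, k). {j, k}) {(j, k) \<in> area_edges n a. \<kappa> j < \<kappa> k}"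
    by (rule inj_onI) (auto simp: doubleton_eq_iff dest!: less)
  have "{e \<in> area_graph n a. \<exists>j k. e = {j, k} \<and> j < k \<and> \<kappa> j < \<kappa> k} =
      (\<lambda>(j, k). {j, k}) ` {(j, k) \<in> area_edges n a. \<kappa> j < \<kappa> k}"
    unfolding area_graph_eq_image
    by (fastforce simp: doubleton_eq_iff dest: less)
  then show ?thesis
    unfolding asc_def by (simp add: card_image[OF inj])
qed

lemma prod_asc_weight:
  assumes "finite R"
  shows "(\<Prod>(j, k)\<in>R. asc_weight (\<kappa> j) (\<kappa> k)) = q ^ card {(j, k) \<in> R. \<kappa> j < \<kappa> k}"
proof -
  have "(\<Prod>(j, k)\<in>R. asc_weight (\<kappa> j) (\<kappa> k)) = (\<Prod>e\<in>{e \<in> R. \<kappa> (fst e) < \<kappa> (snd e)}. q)"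
    using assms by (subst prod.inter_filter)
      (auto simp: asc_weight_def case_prod_beta intro!: prod.cong)
  also have "{e \<in> R. \<kappa> (fst e) < \<kappa> (snd e)} = {(j, k) \<in> R. \<kappa> j < \<kappa> k}"
    by auto
  finally show ?thesis by simp
qed

lemma LLT_area_graph: "LLT n (area_graph n a) = weight_series asc_weight n (area_edges n a)"
  unfolding LLT_def weight_series_def by (simp add: prod_asc_weight asc_area_graph)

lemma prod_proper_asc_weight:
  "(\<Prod>(j, k)\<in>area_edges n a. proper_asc_weight (\<kappa> j) (\<kappa> k)) =
     (if proper (area_graph n a) \<kappa> then q ^ asc (area_graph n a) \<kappa> else 0)"
proof (cases "proper (area_graph n a) \<kappa>")
  case True
  then have "(\<Prod>(j, k)\<in>area_edges n a. proper_asc_weight (\<kappa> j) (\<kappa> k)) =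
      (\<Prod>(j, k)\<in>area_edges n a. asc_weight (\<kappa> j) (\<kappa> k))"
    by (intro prod.cong)
      (auto simp: proper_area_graph_iff asc_weight_def proper_asc_weight_def)
  with True show ?thesis by (simp add: prod_asc_weight asc_area_graph)
next
  case False
  then show ?thesis
    by (force simp: proper_area_graph_iff proper_asc_weight_def intro!: prod_zero)
qed

lemma chromatic_area_graph:
  "chromatic n (area_graph n a) = weight_series proper_asc_weight n (area_edges n a)"
proof
  fix m
  show "chromatic n (area_graph n a) m =
      weight_series proper_asc_weight n (area_edges n a) m"
    unfolding chromatic_def weight_series_def prod_proper_asc_weight
    by (rule sum.mono_neutral_cong_left) (auto simp: finite_colorings_exponent)
qed

subsection \<open>The three-term relation\<close>

lemma exponent_comp_transpose:
  assumes "s \<in> {1..n}" "t \<in> {1..n}"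
  shows "exponent n (\<kappa> \<circ> transpose s t) = exponent n \<kappa>"
proof -
  have "bij_betw (transpose s t) {1..n} {1..n}"
    using assms by (simp add: bij_betw_transpose_iff)
  from sum.reindex_bij_betw[OF this, of "\<lambda>v. Poly_Mapping.single (\<kappa> v) (1::nat)"]
  show ?thesis by (simp add: exponent_def)
qed

lemma comp_transpose_in_colorings:
  assumes "s \<in> {1..n}" "t \<in> {1..n}" "\<kappa> \<in> colorings n"
  shows "\<kappa> \<circ> transpose s t \<in> colorings n"
  using assms unfolding colorings_def
  by (auto simp: PiE_iff extensional_def transpose_def)

text \<open>Exchanging the colors of \<open>s\<close> and \<open>t\<close> permutes the colorings
  with exponent \<open>m\<close> and fixes the product over \<open>D\<close>. What remains for a
  coloring and its partner is the hypothesis on \<open>g\<close>, with \<open>c\<close>,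
  \<open>x\<close>, \<open>y\<close> the colors of \<open>i\<close>, \<open>s\<close>,
  \<open>t\<close>.\<close>

lemma weight_series_three_term:
  fixes g :: "nat \<Rightarrow> nat \<Rightarrow> int poly"
  assumes g: "\<And>c x y. (g c x * g c y + q) * (g x y + g y x) =
      (1 + q) * (g c x * g x y + g c y * g y x)"
    and D: "finite D" "(s, t) \<notin> D" "(i, s) \<notin> D" "(i, t) \<notin> D"
    and inv: "\<And>u v. (u, v) \<in> D \<Longrightarrow> (transpose s t u, transpose s t v) \<in> D"
    and st: "s \<in> {1..n}" "t \<in> {1..n}" "s \<noteq> t" "i \<noteq> s" "i \<noteq> t"
  shows "weight_series g n (insert (i, t) (insert (i, s) (insert (s, t) D))) m +
      q * weight_series g n (insert (s, t) D) m =
      (1 + q) * weight_series g n (insert (i, s) (insert (s, t) D)) m"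
proof -
  let ?\<tau> = "transpose s t"
  define K where "K = {\<kappa> \<in> colorings n. exponent n \<kappa> = m}"
  define P where "P \<kappa> = (\<Prod>(u, v)\<in>D. g (\<kappa> u) (\<kappa> v))" for \<kappa>
  \<comment> \<open>The contribution of one coloring to left side minus right side.\<close>
  define h where "h \<kappa> = P \<kappa> * g (\<kappa> s) (\<kappa> t) *
      (g (\<kappa> i) (\<kappa> s) * g (\<kappa> i) (\<kappa> t) + q - (1 + q) * g (\<kappa> i) (\<kappa> s))" for \<kappa>
  have bij: "bij_betw (\<lambda>\<kappa>. \<kappa> \<circ> ?\<tau>) K K"
    by (rule bij_betw_byWitness[where f' = "\<lambda>\<kappa>. \<kappa> \<circ> ?\<tau>"])
      (use st in \<open>auto simp: K_def exponent_comp_transpose comp_transpose_in_colorings comp_assoc\<close>)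
  have P: "P (\<kappa> \<circ> ?\<tau>) = P \<kappa>" for \<kappa>
  proof -
    have "bij_betw (map_prod ?\<tau> ?\<tau>) D D"
      by (rule bij_betw_byWitness[where f' = "map_prod ?\<tau> ?\<tau>"]) (auto dest: inv)
    from prod.reindex_bij_betw[OF this, of "\<lambda>(u, v). g (\<kappa> u) (\<kappa> v)"]
    show ?thesis by (simp add: P_def case_prod_beta)
  qed
  have h: "h \<kappa> + h (\<kappa> \<circ> ?\<tau>) = 0" for \<kappa>
  proof -
    have "h \<kappa> + h (\<kappa> \<circ> ?\<tau>) = P \<kappa> *
        ((g (\<kappa> i) (\<kappa> s) * g (\<kappa> i) (\<kappa> t) + q) * (g (\<kappa> s) (\<kappa> t) + g (\<kappa> t) (\<kappa> s)) -
         (1 + q) * (g (\<kappa> i) (\<kappa> s) * g (\<kappa> s) (\<kappa> t) + g (\<kappa> i) (\<kappa> t) * g (\<kappa> t) (\<kappa> s)))"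
      using st unfolding h_def P by (simp add: algebra_simps)
    then show ?thesis by (simp add: g)
  qed
  \<comment> \<open>Doubling the sum avoids choosing representatives of the pairs and treating
    colorings fixed by the exchange separately.\<close>
  have "2 * sum h K = sum h K + (\<Sum>\<kappa>\<in>K. h (\<kappa> \<circ> ?\<tau>))"
    by (simp add: sum.reindex_bij_betw[OF bij])
  also have "\<dots> = 0"
    by (simp flip: sum.distrib add: h)
  finally have "sum h K = 0" by simp
  moreover have "sum h K =
      weight_series g n (insert (i, t) (insert (i, s) (insert (s, t) D))) m +
      q * weight_series g n (insert (s, t) D) m -
      (1 + q) * weight_series g n (insert (i, s) (insert (s, t) D)) m"
    using D st unfolding weight_series_def
    by (simp add: sum_distrib_left flip: sum.distrib sum_subtractf K_def P_def)
      (simp add: h_def algebra_simps)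
  ultimately show ?thesis by simp
qed

text \<open>Let A and B be the weights of \<open>c\<close> with \<open>x\<close> and
  \<open>y\<close>. For x < y the difference of the sides is (1 + q)(A - 1)(B - q), and A = 1 unless
  c < x, which forces B = q. For x = y it is 2(A - 1)(A - q).\<close>

lemma asc_weight_relation:
  "(asc_weight c x * asc_weight c y + q) * (asc_weight x y + asc_weight y x) =
     (1 + q) * (asc_weight c x * asc_weight x y + asc_weight c y * asc_weight y x)"
  by (auto simp: asc_weight_def algebra_simps)

text \<open>As for \<open>asc_weight\<close>, with two changes: c = x < y gives A = 0 but B = q, and
  for x = y both sides vanish.\<close>

lemma proper_asc_weight_relation:
  "(proper_asc_weight c x * proper_asc_weight c y + q) *
       (proper_asc_weight x y + proper_asc_weight y x) =
     (1 + q) * (proper_asc_weight c x * proper_asc_weight x y +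
       proper_asc_weight c y * proper_asc_weight y x)"
  by (auto simp: proper_asc_weight_def algebra_simps)

lemma area_sequence_reach_mono:
  assumes "area_sequence n a" "1 \<le> u" "u \<le> v" "v \<le> n"
  shows "int u + a u \<le> int v + a v"
  using assms(3,4)
proof (induction v rule: dec_induct)
  case (step v)
  then have "a (v + 1) \<ge> a v - 1"
    using assms unfolding area_sequence_def by auto
  with step show ?case by simp
qed simp

lemma area_edges_three_term:
  fixes n i j :: nat and a :: "nat \<Rightarrow> int"
  assumes g: "\<And>c x y. (g c x * g c y + q) * (g x y + g y x) =
      (1 + q) * (g c x * g x y + g c y * g y x)"
    and a: "area_sequence n a" and i: "i \<in> {1..n}"
    and lowered: "area_sequence n (lower a i (j + 2))"
    and eq: "a (nat (int i + a i - int (j + 1))) = a (nat (int i + a i - int (j + 1) + 1)) + 1"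
  shows "weight_series g n (area_edges n (lower a i j)) m +
      q * weight_series g n (area_edges n (lower a i (j + 2))) m =
      (1 + q) * weight_series g n (area_edges n (lower a i (j + 1))) m"
proof -
  define s where "s = nat (int i + a i - int (j + 1))"
  have ai: "a i \<ge> int j + 2"
    using bspec[OF conjunct1[OF lowered[unfolded area_sequence_def]] i]
    by (simp add: lower_def)
  have ain: "int i + a i \<le> int n"
    using bspec[OF conjunct1[OF a[unfolded area_sequence_def]] i] by simp
  have s: "int s = int i + a i - int j - 1" "i < s" "s + 1 \<le> n"
    using ai ain by (auto simp: s_def)
  have "nat (int i + a i - int (j + 1) + 1) = s + 1"
    using s by simp
  with eq have reach_s: "int s + a s = int (Suc s) + a (Suc s)"
    by (simp add: s_def)
  let ?C = "area_edges n (lower a i (j + 2))"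
  \<comment> \<open>The edge between \<open>s\<close> and \<open>Suc s\<close> is set aside because
    the exchange would reverse it.\<close>
  define D where "D = ?C - {(s, Suc s)}"
  have "finite D"
    by (simp add: D_def)
  have reach_s': "int s \<le> int s + a s - 1"
  proof -
    have "0 \<le> a (Suc s)"
      using a s unfolding area_sequence_def by auto
    with reach_s show ?thesis by simp
  qed
  \<comment> \<open>The lowered sequence is needed here: in it \<open>i\<close> reaches only to s -
    1, which bounds the reach of all earlier vertices.\<close>
  have before: "int u + a u < int s" if "1 \<le> u" "u < i" for u
    using area_sequence_reach_mono[OF lowered, of u i] that i s
    by (auto simp: lower_def)
  have after: "int (Suc s) \<le> int u + a u" if "i < u" "u \<le> n" for u
    using area_sequence_reach_mono[OF a, of i u] that i s by auto
  have left: "(u, s) \<in> ?C \<longleftrightarrow> (u, Suc s) \<in> ?C" if "u \<noteq> s" "u \<noteq> Suc s" for u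
    using that before[of u] after[of u] s
    by (cases "u < i"; cases "u = i") (auto simp: area_edges_def lower_def)
  have right: "(s, v) \<in> ?C \<longleftrightarrow> (Suc s, v) \<in> ?C" if "v \<noteq> s" "v \<noteq> Suc s" for v
    using that reach_s s by (auto simp: area_edges_def lower_def)
  have irrefl: "v < w" if "(v, w) \<in> ?C" for v w
    using that by (auto simp: area_edges_def)
  \<comment> \<open>A vertex other than \<open>s\<close> and \<open>Suc s\<close> sees both or
    neither from the left by \<open>left\<close>, and is seen by both or neither by
    \<open>right\<close>.\<close>
  have inv: "(transpose s (Suc s) u, transpose s (Suc s) v) \<in> D" if "(u, v) \<in> D" for u v
    using that left[of u] right[of v] irrefl[of u v] unfolding D_def
    by (auto simp: transpose_def)
  have C: "(s, Suc s) \<in> ?C"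
    using s reach_s' by (auto simp: area_edges_def lower_def)
  then have C_eq: "?C = insert (s, Suc s) D"
    by (auto simp: D_def)
  have C1_eq: "area_edges n (lower a i (j + 1)) = insert (i, s) ?C"
    using s i by (auto simp: area_edges_def lower_def)
  have C0_eq: "area_edges n (lower a i j) = insert (i, Suc s) (insert (i, s) ?C)"
    using s i by (auto simp: area_edges_def lower_def)
  show ?thesis
    unfolding C0_eq C1_eq unfolding C_eq
    by (rule weight_series_three_term[OF g \<open>finite D\<close> _ _ _ inv])
      (use s i in \<open>auto simp: D_def area_edges_def lower_def\<close>)
qed

subsection \<open>Solving the recurrence\<close>

lemma q_int_Suc: "q_int (Suc k) = 1 + q * q_int k"
  unfolding q_int_def by (subst sum.lessThan_Suc_shift) (simp add: sum_distrib_left)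

lemma q_int_add: "q_int (m + k) = q_int m + q ^ m * q_int k"
  by (induction m) (auto simp: q_int_Suc algebra_simps, simp add: q_int_def)

context
  fixes f :: "nat \<Rightarrow> int poly" and l :: nat
  assumes rec: "\<And>j. j + 2 \<le> l \<Longrightarrow> f j + q * f (j + 2) = (1 + q) * f (j + 1)"
begin

text \<open>The recurrence says that consecutive differences form a geometric progression; the
  lemmas below sum it.\<close>

lemma three_term_diff:
  assumes "Suc j < l"
  shows "f j - f (Suc j) = q * (f (Suc j) - f (Suc (Suc j)))"
  using rec[of j] assms by (simp add: algebra_simps)

lemma three_term_diff_power:
  assumes "k + m < l"
  shows "f k - f (Suc k) = q ^ m * (f (k + m) - f (Suc (k + m)))"
  using assms
proof (induction m)
  case (Suc m)
  then show ?case
    using three_term_diff[of "k + m"] by simp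
qed simp

lemma three_term_from_start:
  assumes "k < l"
  shows "f 0 - f k = q * q_int k * (f k - f (Suc k))"
  using assms
proof (induction k)
  case 0
  show ?case by (simp add: q_int_def)
next
  case (Suc k)
  have "f 0 - f (Suc k) = (f 0 - f k) + (f k - f (Suc k))"
    by simp
  also have "\<dots> = q_int (Suc k) * (f k - f (Suc k))"
    using Suc by (simp add: q_int_Suc algebra_simps)
  also have "\<dots> = q * q_int (Suc k) * (f (Suc k) - f (Suc (Suc k)))"
    using three_term_diff[of k] Suc.prems by simp
  finally show ?case .
qed

text \<open>Later differences are the one at \<open>k\<close> divided by powers of q; the factor
  \<open>q ^ m\<close> clears these denominators.\<close>

lemma three_term_to_end:
  assumes "k + m \<le> l"
  shows "q ^ m * (f k - f (k + m)) = q * q_int m * (f k - f (Suc k))"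
  using assms
proof (induction m)
  case 0
  then show ?case by (simp add: q_int_def)
next
  case (Suc m)
  have "q ^ Suc m * (f k - f (k + Suc m)) =
      q * (q ^ m * (f k - f (k + m))) + q * (q ^ m * (f (k + m) - f (Suc (k + m))))"
    by (simp add: algebra_simps)
  also have "\<dots> = q * (q * q_int m * (f k - f (Suc k))) + q * (f k - f (Suc k))"
    using Suc three_term_diff_power[of k m] by simp
  also have "\<dots> = q * q_int (Suc m) * (f k - f (Suc k))"
    by (simp add: q_int_Suc algebra_simps)
  finally show ?case .
qed

lemma three_term_solution_start:
  assumes "k < l"
  shows "f 0 + q * q_int k * f (k + 1) = q_int (k + 1) * f k"
  using three_term_from_start[OF assms] by (simp add: q_int_Suc algebra_simps)

text \<open>Multiplying the two telescoped sums by \<open>q_int (l - k)\<close> and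
  \<open>q_int k\<close> gives the same multiple of \<open>f k - f (Suc k)\<close>, which is thereby
  eliminated.\<close>

lemma three_term_solution_end:
  assumes "k < l"
  shows "q_int (l - k) * f 0 + q ^ (l - k) * q_int k * f l = q_int l * f k"
proof -
  have split: "q_int l = q_int (l - k) + q ^ (l - k) * q_int k"
    using q_int_add[of "l - k" k] assms by simp
  have "q_int (l - k) * (f 0 - f k) = q_int k * (q * q_int (l - k) * (f k - f (Suc k)))"
    using three_term_from_start[OF assms] by simp
  also have "\<dots> = q_int k * (q ^ (l - k) * (f k - f l))"
    using three_term_to_end[of k "l - k"] assms by simp
  finally show ?thesis
    unfolding split by (simp add: algebra_simps)
qed

end

theorem theorem3p4:
  fixes n l i k :: nat and a :: "nat \<Rightarrow> int" and G :: "nat \<Rightarrow> nat set set"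
  defines "G \<equiv> \<lambda>z. area_graph n (lower a i z)"
  assumes "n \<ge> 3" and "area_sequence n a"
    and "2 \<le> l" and "l \<le> n - 1" and "i \<in> {1..n}"
    and "(if i = 1 then 1 else a (i - 1)) + int l - 1 \<le> a i"
    and "\<And>z. z \<in> {0..l} \<Longrightarrow> area_sequence n (lower a i z)"
    and "\<And>t. t \<in> {1..l - 1} \<Longrightarrow>
           a (nat (int i + a i - int t)) = a (nat (int i + a i - int t + 1)) + 1"
    and "1 \<le> k" and "k \<le> l - 1"
  shows "LLT n (G 0) + (q * q_int k) \<cdot> LLT n (G (k + 1)) = q_int (k + 1) \<cdot> LLT n (G k)
    \<and> q_int (l - k) \<cdot> LLT n (G 0) + (q ^ (l - k) * q_int k) \<cdot> LLT n (G l)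
        = q_int l \<cdot> LLT n (G k)
    \<and> chromatic n (G 0) + (q * q_int k) \<cdot> chromatic n (G (k + 1))
        = q_int (k + 1) \<cdot> chromatic n (G k)
    \<and> q_int (l - k) \<cdot> chromatic n (G 0) + (q ^ (l - k) * q_int k) \<cdot> chromatic n (G l)
        = q_int l \<cdot> chromatic n (G k)"
proof -
  have kl: "k < l" using assms(4,10,11) by simp
  \<comment> \<open>For j + 2 \<le> l the index j + 1 lies in {1..l - 1}, the range where the
    condition on consecutive values of \<open>a\<close> is assumed.\<close>
  have rec: "weight_series g n (area_edges n (lower a i j)) m +
      q * weight_series g n (area_edges n (lower a i (j + 2))) m =
      (1 + q) * weight_series g n (area_edges n (lower a i (j + 1))) m"
    if "\<And>c x y. (g c x * g c y + q) * (g x y + g y x) =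
      (1 + q) * (g c x * g x y + g c y * g y x)" and "j + 2 \<le> l" for g j m
    using area_edges_three_term[OF that(1) assms(3,6) assms(8)[of "j + 2"] assms(9)[of "j + 1"]]
      that(2) by simp
  have solution: "F 0 + (q * q_int k) \<cdot> F (k + 1) = q_int (k + 1) \<cdot> F k \<and>
      q_int (l - k) \<cdot> F 0 + (q ^ (l - k) * q_int k) \<cdot> F l = q_int l \<cdot> F k"
    if "\<And>j m. j + 2 \<le> l \<Longrightarrow> F j m + q * F (j + 2) m = (1 + q) * F (j + 1) m"
    for F :: "nat \<Rightarrow> series"
    using three_term_solution_start[of l "\<lambda>z. F z _" k, OF that kl]
      three_term_solution_end[of l "\<lambda>z. F z _" k, OF that kl]
    by (simp add: fun_eq_iff scale_def)
  show ?thesis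
    using solution[of "\<lambda>z. LLT n (G z)"] solution[of "\<lambda>z. chromatic n (G z)"]
      rec[of asc_weight, OF asc_weight_relation]
      rec[of proper_asc_weight, OF proper_asc_weight_relation]
    unfolding G_def LLT_area_graph chromatic_area_graph by blast
qed

end
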